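(* Let $T$ be a trivial rack, $x_0\in T$ and $R$ an associative ring with unity. Then $$\mathcal{U}_1(R^\circ[T])=\{e+a+\alpha(x_0-e)\mid a\in\Delta_R(T)\ \text{and}\ \alpha\in R\ \text{with}\ \alpha-1\in R^*\}.$$
   Context: A trivial rack is a non-empty set $T$ with the operation $x.y=x$ for all $x,y\in T$. The rack ring $R[T]$ is the set of formal finite $R$-linear combinations of elements of $T$ with the usual addition and multiplication $(\sum_i\alpha_i x_i).(\sum_j\beta_j x_j)=\sum_{i,j}\alpha_i\beta_j(x_i.x_j)$. The extended rack ring is $R^\circ[T]=R[T]\oplus Re$, where $e$ is a symbol acting as a two-sided identity; for trivial $T$ it is an associative ring with unity $e$. The augmentation map $\varepsilon:R^\circ[T]\to R$ is $\varepsilon(\sum_i\alpha_i x_i+\beta e)=\sum_i\alpha_i+\beta$. $\Delta_R(T)=\{a\in R[T]\mid\varepsilon(a)=0\}$. $\mathcal{U}(R^\circ[T])$ is the group of units of $R^\circ[T]$, $\mathcal{U}_1(R^\circ[T])=\{u\in\mathcal{U}(R^\circ[T])\mid\varepsilon(u)=1\}$, and $R^*$ is the group of units of $R$. *)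

theory Defs
  imports "HOL-Algebra.Module"
begin

definition trivial_rack :: "'t set \<Rightarrow> ('t \<Rightarrow> 't \<Rightarrow> 't) \<Rightarrow> bool" where
  "trivial_rack T m \<longleftrightarrow> T \<noteq> {} \<and> (\<forall>x\<in>T. \<forall>y\<in>T. m x y = x)"

definition supp :: "('r, 'k) ring_scheme \<Rightarrow> ('t \<Rightarrow> 'r) \<Rightarrow> 't set" where
  "supp R f = {x. f x \<noteq> \<zero>\<^bsub>R\<^esub>}"

text \<open>A formal finite combination of elements of \<open>T\<close> is encoded by its coefficient function, which
  is total on the ambient type and vanishes outside \<open>T\<close>.\<close>

definition rack_ring_carrier :: "('r, 'k) ring_scheme \<Rightarrow> 't set \<Rightarrow> ('t \<Rightarrow> 'r) set" where
  "rack_ring_carrier R T = {f. range f \<subseteq> carrier R \<and> supp R f \<subseteq> T \<and> finite (supp R f)}"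

definition rack_ring_mult ::
    "('r, 'k) ring_scheme \<Rightarrow> ('t \<Rightarrow> 't \<Rightarrow> 't) \<Rightarrow> ('t \<Rightarrow> 'r) \<Rightarrow> ('t \<Rightarrow> 'r) \<Rightarrow> ('t \<Rightarrow> 'r)" where
  "rack_ring_mult R m f g =
     (\<lambda>z. \<Oplus>\<^bsub>R\<^esub>p\<in>{p \<in> supp R f \<times> supp R g. m (fst p) (snd p) = z}. f (fst p) \<otimes>\<^bsub>R\<^esub> g (snd p))"

text \<open>The pair \<open>(f, \<alpha>)\<close> stands for \<open>f + \<alpha>e\<close>. The product is the bilinear extension of the product
  of the rack ring for which \<open>e\<close> is a two-sided identity:
  \<open>(f + \<alpha>e)(g + \<beta>e) = fg + f\<beta> + \<alpha>g + \<alpha>\<beta>e\<close>.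
  The record type \<open>module\<close> serves only to provide the left scalar multiplication;
  \<open>R\<close> need not be commutative.\<close>

definition ext_rack_ring ::
    "('r, 'k) ring_scheme \<Rightarrow> 't set \<Rightarrow> ('t \<Rightarrow> 't \<Rightarrow> 't) \<Rightarrow> ('r, ('t \<Rightarrow> 'r) \<times> 'r) module" where
  "ext_rack_ring R T m =
    \<lparr> carrier = rack_ring_carrier R T \<times> carrier R,
      mult = (\<lambda>(f, \<alpha>) (g, \<beta>).
        (\<lambda>z. rack_ring_mult R m f g z \<oplus>\<^bsub>R\<^esub> f z \<otimes>\<^bsub>R\<^esub> \<beta> \<oplus>\<^bsub>R\<^esub> \<alpha> \<otimes>\<^bsub>R\<^esub> g z, \<alpha> \<otimes>\<^bsub>R\<^esub> \<beta>)),
      one = (\<lambda>_. \<zero>\<^bsub>R\<^esub>, \<one>\<^bsub>R\<^esub>),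
      zero = (\<lambda>_. \<zero>\<^bsub>R\<^esub>, \<zero>\<^bsub>R\<^esub>),
      add = (\<lambda>(f, \<alpha>) (g, \<beta>). (\<lambda>z. f z \<oplus>\<^bsub>R\<^esub> g z, \<alpha> \<oplus>\<^bsub>R\<^esub> \<beta>)),
      smult = (\<lambda>\<gamma> (f, \<alpha>). (\<lambda>z. \<gamma> \<otimes>\<^bsub>R\<^esub> f z, \<gamma> \<otimes>\<^bsub>R\<^esub> \<alpha>)) \<rparr>"

text \<open>An element of \<open>T\<close>, as an element of the extended rack ring.\<close>

definition rack_elem :: "('r, 'k) ring_scheme \<Rightarrow> 't \<Rightarrow> ('t \<Rightarrow> 'r) \<times> 'r" where
  "rack_elem R x = (\<lambda>y. if y = x then \<one>\<^bsub>R\<^esub> else \<zero>\<^bsub>R\<^esub>, \<zero>\<^bsub>R\<^esub>)"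

definition augmentation :: "('r, 'k) ring_scheme \<Rightarrow> ('t \<Rightarrow> 'r) \<times> 'r \<Rightarrow> 'r" where
  "augmentation R u = (\<Oplus>\<^bsub>R\<^esub>x\<in>supp R (fst u). fst u x) \<oplus>\<^bsub>R\<^esub> snd u"

text \<open>The set \<open>\<Delta>\<^sub>R(T)\<close>, inside the extended rack ring: the elements of the rack ring are the pairs
  with second component zero.\<close>

definition augmentation_ideal ::
    "('r, 'k) ring_scheme \<Rightarrow> 't set \<Rightarrow> (('t \<Rightarrow> 'r) \<times> 'r) set" where
  "augmentation_ideal R T =
     {a \<in> rack_ring_carrier R T \<times> {\<zero>\<^bsub>R\<^esub>}. augmentation R a = \<zero>\<^bsub>R\<^esub>}"

definition normalized_units ::
    "('r, 'k) ring_scheme \<Rightarrow> 't set \<Rightarrow> ('t \<Rightarrow> 't \<Rightarrow> 't) \<Rightarrow> (('t \<Rightarrow> 'r) \<times> 'r) set" where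
  "normalized_units R T m = {u \<in> Units (ext_rack_ring R T m). augmentation R u = \<one>\<^bsub>R\<^esub>}"

end

theory Submission
  imports Defs
begin

text \<open>In a trivial rack \<open>fg = f\<epsilon>(g)\<close>, so
  \<open>(f + \<alpha>e)v = f\<epsilon>(v) + \<alpha>v\<close> with the \<open>e\<close>-coefficients multiplying as in \<open>R\<close>. Hence the
  \<open>e\<close>-coefficient of a unit is a unit of \<open>R\<close>; conversely, if \<open>\<epsilon>(f + \<alpha>e) = 1\<close> and \<open>\<alpha>\<close> is
  invertible, then \<open>-\<alpha>\<^sup>-\<^sup>1f + \<alpha>\<^sup>-\<^sup>1e\<close> is a two-sided inverse of \<open>f + \<alpha>e\<close>. Finally
  \<open>e + a + \<gamma>(x\<^sub>0 - e)\<close> with \<open>\<epsilon>(a) = 0\<close> is the general element of augmentation one,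
  and its \<open>e\<close>-coefficient is \<open>1 - \<gamma>\<close>.\<close>

context ring
begin

section \<open>Finitely supported coefficient functions\<close>

lemma rack_ring_carrierI:
  assumes "\<And>z. f z \<in> carrier R" "supp R f \<subseteq> A" "A \<subseteq> T" "finite A"
  shows "f \<in> rack_ring_carrier R T"
  using assms by (auto simp: rack_ring_carrier_def intro: finite_subset)

lemma rack_ring_carrierD:
  assumes "f \<in> rack_ring_carrier R T"
  shows "f z \<in> carrier R" "supp R f \<subseteq> T" "finite (supp R f)"
  using assms by (auto simp: rack_ring_carrier_def)

lemma rack_ring_zero_closed: "(\<lambda>_. \<zero>) \<in> rack_ring_carrier R T"
  by (rule rack_ring_carrierI[where A = "{}"]) (auto simp: supp_def)

lemma rack_ring_add_closed:
  assumes "f \<in> rack_ring_carrier R T" "g \<in> rack_ring_carrier R T"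
  shows "(\<lambda>z. f z \<oplus> g z) \<in> rack_ring_carrier R T"
  using rack_ring_carrierD[OF assms(1)] rack_ring_carrierD[OF assms(2)]
  by (intro rack_ring_carrierI[where A = "supp R f \<union> supp R g"]) (auto simp: supp_def)

lemma rack_ring_lmult_closed:
  assumes "f \<in> rack_ring_carrier R T" "\<gamma> \<in> carrier R"
  shows "(\<lambda>z. \<gamma> \<otimes> f z) \<in> rack_ring_carrier R T"
  using rack_ring_carrierD[OF assms(1)] assms(2)
  by (intro rack_ring_carrierI[where A = "supp R f"]) (auto simp: supp_def)

lemma rack_ring_a_inv_closed:
  assumes "f \<in> rack_ring_carrier R T"
  shows "(\<lambda>z. \<ominus> f z) \<in> rack_ring_carrier R T"
  using rack_ring_carrierD[OF assms]
  by (intro rack_ring_carrierI[where A = "supp R f"]) (auto simp: supp_def)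

lemma rack_elem_closed:
  assumes "x \<in> T"
  shows "rack_elem R x \<in> rack_ring_carrier R T \<times> {\<zero>}"
  using assms by (auto simp: rack_elem_def supp_def split: if_splits
      intro!: rack_ring_carrierI[where A = "{x}"])

text \<open>The augmentation sums over the exact support, which may shrink when coefficients cancel.
  Padding with zero terms moves sums over different supports to a common finite index set.\<close>

lemma finsum_supp_superset:
  assumes "f \<in> rack_ring_carrier R T" "finite A" "supp R f \<subseteq> A"
  shows "(\<Oplus>x\<in>supp R f. f x) = (\<Oplus>x\<in>A. f x)"
  using rack_ring_carrierD[OF assms(1)] assms(2,3)
  by (intro add.finprod_mono_neutral_cong_left) (auto simp: supp_def)

section \<open>Left linearity of the augmentation\<close>

lemma augmentation_closed:
  assumes "f \<in> rack_ring_carrier R T" "\<alpha> \<in> carrier R"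
  shows "augmentation R (f, \<alpha>) \<in> carrier R"
  using rack_ring_carrierD[OF assms(1)] assms(2) by (auto simp: augmentation_def)

lemma augmentation_add:
  assumes "f \<in> rack_ring_carrier R T" "g \<in> rack_ring_carrier R T"
    and "\<alpha> \<in> carrier R" "\<beta> \<in> carrier R"
  shows "augmentation R (\<lambda>z. f z \<oplus> g z, \<alpha> \<oplus> \<beta>) =
    augmentation R (f, \<alpha>) \<oplus> augmentation R (g, \<beta>)"
proof -
  note f = rack_ring_carrierD[OF assms(1)] and g = rack_ring_carrierD[OF assms(2)]
  let ?A = "supp R f \<union> supp R g"
  have A: "finite ?A" "supp R (\<lambda>z. f z \<oplus> g z) \<subseteq> ?A"
    using f g by (auto simp: supp_def)
  have "(\<Oplus>x\<in>supp R (\<lambda>z. f z \<oplus> g z). f x \<oplus> g x) = (\<Oplus>x\<in>?A. f x \<oplus> g x)"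
    by (rule finsum_supp_superset[OF rack_ring_add_closed[OF assms(1,2)] A])
  also have "\<dots> = (\<Oplus>x\<in>?A. f x) \<oplus> (\<Oplus>x\<in>?A. g x)"
    using f(1) g(1) by (intro finsum_addf) auto
  also have "\<dots> = (\<Oplus>x\<in>supp R f. f x) \<oplus> (\<Oplus>x\<in>supp R g. g x)"
    using finsum_supp_superset[OF assms(1) A(1)] finsum_supp_superset[OF assms(2) A(1)] by simp
  finally show ?thesis
    using f(1) g(1) assms(3,4) by (simp add: augmentation_def Pi_def a_ac)
qed

lemma augmentation_lmult:
  assumes "f \<in> rack_ring_carrier R T" "\<alpha> \<in> carrier R" "\<gamma> \<in> carrier R"
  shows "augmentation R (\<lambda>z. \<gamma> \<otimes> f z, \<gamma> \<otimes> \<alpha>) = \<gamma> \<otimes> augmentation R (f, \<alpha>)"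
proof -
  note f = rack_ring_carrierD[OF assms(1)]
  \<comment> \<open>\<open>R\<close> may have zero divisors, so \<gamma> can annihilate some nonzero
    coefficients of \<open>f\<close>.\<close>
  have "(\<Oplus>x\<in>supp R (\<lambda>z. \<gamma> \<otimes> f z). \<gamma> \<otimes> f x) = (\<Oplus>x\<in>supp R f. \<gamma> \<otimes> f x)"
    using f assms(3)
    by (intro finsum_supp_superset[OF rack_ring_lmult_closed[OF assms(1,3)]]) (auto simp: supp_def)
  also have "\<dots> = \<gamma> \<otimes> (\<Oplus>x\<in>supp R f. f x)"
    using f assms(3) by (intro finsum_rdistr[symmetric]) auto
  finally show ?thesis
    using f assms(2,3) by (simp add: augmentation_def Pi_def r_distr)
qed

lemma augmentation_scalar: "\<alpha> \<in> carrier R \<Longrightarrow> augmentation R (\<lambda>_. \<zero>, \<alpha>) = \<alpha>"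
  by (simp add: augmentation_def supp_def)

lemma augmentation_rack_elem: "augmentation R (rack_elem R x) = \<one>"
proof -
  \<comment> \<open>The zero ring is allowed: there the support is empty, and the empty sum still
    equals \<one>.\<close>
  have "supp R (fst (rack_elem R x)) = (if \<one> = \<zero> then {} else {x})"
    by (auto simp: supp_def rack_elem_def)
  then show ?thesis
    by (auto simp: augmentation_def rack_elem_def)
qed

section \<open>Componentwise operations of the extended rack ring\<close>

lemma ext_rack_ring_carrier_iff:
  "(f, \<alpha>) \<in> carrier (ext_rack_ring R T m) \<longleftrightarrow> f \<in> rack_ring_carrier R T \<and> \<alpha> \<in> carrier R"
  by (simp add: ext_rack_ring_def)

lemma ext_rack_ring_one: "\<one>\<^bsub>ext_rack_ring R T m\<^esub> = (\<lambda>_. \<zero>, \<one>)"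
  by (simp add: ext_rack_ring_def)

lemma ext_rack_ring_add:
  "(f, \<alpha>) \<oplus>\<^bsub>ext_rack_ring R T m\<^esub> (g, \<beta>) = (\<lambda>z. f z \<oplus> g z, \<alpha> \<oplus> \<beta>)"
  by (simp add: ext_rack_ring_def)

lemma ext_rack_ring_smult:
  "\<gamma> \<odot>\<^bsub>ext_rack_ring R T m\<^esub> (f, \<alpha>) = (\<lambda>z. \<gamma> \<otimes> f z, \<gamma> \<otimes> \<alpha>)"
  by (simp add: ext_rack_ring_def)

text \<open>The negative is a definite description in the additive monoid. No ring structure on
  \<open>ext_rack_ring\<close> has been established, so existence and uniqueness are reduced to
  negation in \<open>R\<close>, coefficient by coefficient.\<close>

lemma ext_rack_ring_a_inv:
  assumes "f \<in> rack_ring_carrier R T" "\<alpha> \<in> carrier R"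
  shows "\<ominus>\<^bsub>ext_rack_ring R T m\<^esub> (f, \<alpha>) = (\<lambda>z. \<ominus> f z, \<ominus> \<alpha>)"
  unfolding a_inv_def[of "ext_rack_ring R T m"] m_inv_def
proof (rule the_equality, goal_cases)
  case 1
  then show ?case
    using assms rack_ring_carrierD(1)[OF assms(1)]
    by (simp add: ext_rack_ring_def rack_ring_a_inv_closed r_neg l_neg)
next
  case (2 v)
  then obtain g \<beta> where v: "v = (g, \<beta>)" "g \<in> rack_ring_carrier R T" "\<beta> \<in> carrier R"
    and eq: "(\<lambda>z. g z \<oplus> f z) = (\<lambda>_. \<zero>)" "\<beta> \<oplus> \<alpha> = \<zero>"
    by (auto simp: ext_rack_ring_def)
  have "g z = \<ominus> f z" for z
    using fun_cong[OF eq(1), of z] rack_ring_carrierD(1)[OF assms(1)] rack_ring_carrierD(1)[OF v(2)]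
    by (simp add: minus_equality)
  moreover have "\<beta> = \<ominus> \<alpha>"
    using eq(2) assms(2) v(3) by (simp add: minus_equality)
  ultimately show ?case
    using v(1) by auto
qed

section \<open>Products and units over a trivial rack\<close>

lemma rack_ring_mult_trivial:
  assumes "trivial_rack T m" "f \<in> rack_ring_carrier R T" "g \<in> rack_ring_carrier R T"
  shows "rack_ring_mult R m f g z = f z \<otimes> (\<Oplus>y\<in>supp R g. g y)"
proof -
  note f = rack_ring_carrierD[OF assms(2)] and g = rack_ring_carrierD[OF assms(3)]
  let ?P = "{p \<in> supp R f \<times> supp R g. m (fst p) (snd p) = z}"
  \<comment> \<open>Since \<open>x.y = x\<close>, a pair multiplies to \<open>z\<close> exactly when
    its first entry is \<open>z\<close>.\<close>
  have P: "?P = (if z \<in> supp R f then Pair z ` supp R g else {})"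
    using f(2) g(2) assms(1) by (auto simp: trivial_rack_def subset_iff)
  show ?thesis
  proof (cases "z \<in> supp R f")
    case True
    then have "rack_ring_mult R m f g z = (\<Oplus>p\<in>Pair z ` supp R g. f (fst p) \<otimes> g (snd p))"
      using P by (simp add: rack_ring_mult_def)
    also have "\<dots> = (\<Oplus>y\<in>supp R g. f z \<otimes> g y)"
      using f(1) g(1) by (subst add.finprod_reindex) (auto simp: inj_on_def)
    also have "\<dots> = f z \<otimes> (\<Oplus>y\<in>supp R g. g y)"
      using f(1) g by (intro finsum_rdistr[symmetric]) auto
    finally show ?thesis .
  next
    case False
    then have "f z = \<zero>" by (simp add: supp_def)
    moreover have "rack_ring_mult R m f g z = \<zero>"
      by (simp only: rack_ring_mult_def P False if_False finsum_empty)
    ultimately show ?thesis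
      using g(1) by (simp add: Pi_def)
  qed
qed

text \<open>The terms \<open>fg\<close> and \<open>f\<beta>\<close> merge by distributivity into
  \<open>f\<close> times the augmentation of the right factor. A right factor of augmentation one
  thus leaves \<open>f\<close> unchanged.\<close>

lemma ext_rack_ring_mult_trivial:
  assumes "trivial_rack T m" "f \<in> rack_ring_carrier R T" "g \<in> rack_ring_carrier R T"
    and "\<beta> \<in> carrier R"
  shows "(f, \<alpha>) \<otimes>\<^bsub>ext_rack_ring R T m\<^esub> (g, \<beta>) =
    (\<lambda>z. f z \<otimes> augmentation R (g, \<beta>) \<oplus> \<alpha> \<otimes> g z, \<alpha> \<otimes> \<beta>)"
  using rack_ring_carrierD(1)[OF assms(2)] rack_ring_carrierD(1)[OF assms(3)] assms(4)
  by (simp add: ext_rack_ring_def rack_ring_mult_trivial[OF assms(1-3)] augmentation_def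
      r_distr Pi_def)

lemma normalized_units_trivial:
  assumes "trivial_rack T m"
  shows "normalized_units R T m =
    {(f, \<alpha>). f \<in> rack_ring_carrier R T \<and> \<alpha> \<in> Units R \<and> augmentation R (f, \<alpha>) = \<one>}"
    (is "_ = ?S")
proof (intro Set.equalityI subsetI)
  fix u
  assume "u \<in> normalized_units R T m"
  then obtain v where u: "u \<in> carrier (ext_rack_ring R T m)" "augmentation R u = \<one>"
    and v: "v \<in> carrier (ext_rack_ring R T m)"
      "v \<otimes>\<^bsub>ext_rack_ring R T m\<^esub> u = \<one>\<^bsub>ext_rack_ring R T m\<^esub>"
      "u \<otimes>\<^bsub>ext_rack_ring R T m\<^esub> v = \<one>\<^bsub>ext_rack_ring R T m\<^esub>"
    by (auto simp: normalized_units_def Units_def)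
  obtain f \<alpha> g \<beta> where [simp]: "u = (f, \<alpha>)" "v = (g, \<beta>)"
    by (metis prod.exhaust)
  \<comment> \<open>The second components of the two product equations make \<beta> a two-sided
    inverse of \<alpha>.\<close>
  show "u \<in> ?S"
    using u v by (auto simp: ext_rack_ring_def Units_def)
next
  fix u
  assume "u \<in> ?S"
  then obtain f \<alpha> where u [simp]: "u = (f, \<alpha>)" and f: "f \<in> rack_ring_carrier R T"
    and \<alpha>: "\<alpha> \<in> Units R" and aug: "augmentation R (f, \<alpha>) = \<one>"
    by auto
  let ?\<beta> = "inv \<alpha>"
  \<comment> \<open>As \<open>(f, \<alpha>)\<close> has augmentation one, the first component of
    \<open>(g, \<beta>)(f, \<alpha>)\<close> is \<open>g + \<beta>f\<close>; its vanishing dictates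
    this \<open>g\<close>.\<close>
  let ?g = "\<lambda>z. (\<ominus> ?\<beta>) \<otimes> f z"
  have \<alpha>': "\<alpha> \<in> carrier R" "?\<beta> \<in> carrier R" "\<alpha> \<otimes> ?\<beta> = \<one>" "?\<beta> \<otimes> \<alpha> = \<one>"
    using \<alpha> by auto
  note fz = rack_ring_carrierD(1)[OF f]
  have g: "?g \<in> rack_ring_carrier R T"
    using \<alpha>' f by (intro rack_ring_lmult_closed) auto
  \<comment> \<open>The candidate is split as
    \<open>-\<beta>(f + \<alpha>e) + (1 + \<beta>)e\<close>, using
    \<open>\<beta>\<alpha> = 1\<close>. Linearity then yields
    \<open>-\<beta> + 1 + \<beta> = 1\<close>, which is needed for the product with the candidate on
    the right.\<close>
  have "augmentation R (?g, ?\<beta>) =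
      augmentation R (\<lambda>z. ?g z \<oplus> \<zero>, (\<ominus> ?\<beta>) \<otimes> \<alpha> \<oplus> (\<one> \<oplus> ?\<beta>))"
    using \<alpha>' fz by (simp add: l_minus r_neg1)
  also have "\<dots> = (\<ominus> ?\<beta>) \<otimes> augmentation R (f, \<alpha>) \<oplus> (\<one> \<oplus> ?\<beta>)"
    using \<alpha>' f g by (subst augmentation_add)
      (auto simp: rack_ring_zero_closed augmentation_lmult augmentation_scalar)
  also have "\<dots> = \<one>"
    using \<alpha>' aug by (simp add: a_comm[of \<one>] r_neg1)
  finally have aug': "augmentation R (?g, ?\<beta>) = \<one>" .
  have "?\<beta> \<otimes> f z \<in> carrier R" "\<alpha> \<otimes> (?\<beta> \<otimes> f z) = f z" for z
    using \<alpha>' fz by (simp_all add: m_assoc[symmetric])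
  then have "(f, \<alpha>) \<otimes>\<^bsub>ext_rack_ring R T m\<^esub> (?g, ?\<beta>) = \<one>\<^bsub>ext_rack_ring R T m\<^esub>"
    "(?g, ?\<beta>) \<otimes>\<^bsub>ext_rack_ring R T m\<^esub> (f, \<alpha>) = \<one>\<^bsub>ext_rack_ring R T m\<^esub>"
    using \<alpha>' f g fz
    unfolding ext_rack_ring_mult_trivial[OF assms f g \<alpha>'(2)]
      ext_rack_ring_mult_trivial[OF assms g f \<alpha>'(1)] aug aug'
    by (simp_all add: ext_rack_ring_one l_minus r_minus r_neg l_neg)
  moreover have "(?g, ?\<beta>) \<in> carrier (ext_rack_ring R T m)"
    using \<alpha>' g by (simp add: ext_rack_ring_carrier_iff)
  ultimately show "u \<in> normalized_units R T m"
    using f aug \<alpha>' unfolding normalized_units_def Units_def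
    by (auto simp: ext_rack_ring_carrier_iff)
qed

section \<open>Parametrization of the elements of augmentation one\<close>

lemma a_inv_Units_iff:
  assumes "a \<in> carrier R"
  shows "\<ominus> a \<in> Units R \<longleftrightarrow> a \<in> Units R"
proof -
  have "\<ominus> b \<in> Units R" if "b \<in> Units R" for b
  proof -
    have "\<ominus> (inv b) \<otimes> \<ominus> b = \<one>" "\<ominus> b \<otimes> \<ominus> (inv b) = \<one>"
      using that Units_closed[OF that] by (simp_all add: l_minus r_minus)
    moreover have "\<ominus> b \<in> carrier R" "\<ominus> (inv b) \<in> carrier R"
      using that Units_closed[OF that] by simp_all
    ultimately show ?thesis
      unfolding Units_def by blast
  qed
  \<comment> \<open>The converse is the same implication applied to \<open>\<ominus> a\<close>, by
    double negation.\<close>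
  from this[of a] this[of "\<ominus> a"] show ?thesis
    using assms by auto
qed

text \<open>The \<open>e\<close>-coefficient \<open>1 - \<gamma>\<close> is kept as the negative of
  \<open>\<gamma> - 1\<close>, so that \<open>a_inv_Units_iff\<close> links it directly to the unit
  condition of the theorem.\<close>

lemma one_add_smult_diff:
  assumes "x \<in> T" "a \<in> rack_ring_carrier R T" "\<gamma> \<in> carrier R"
  shows "\<one>\<^bsub>ext_rack_ring R T m\<^esub> \<oplus>\<^bsub>ext_rack_ring R T m\<^esub> (a, \<zero>) \<oplus>\<^bsub>ext_rack_ring R T m\<^esub>
      \<gamma> \<odot>\<^bsub>ext_rack_ring R T m\<^esub>
        (rack_elem R x \<ominus>\<^bsub>ext_rack_ring R T m\<^esub> \<one>\<^bsub>ext_rack_ring R T m\<^esub>) =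
    (\<lambda>z. a z \<oplus> \<gamma> \<otimes> fst (rack_elem R x) z, \<ominus> (\<gamma> \<ominus> \<one>))"
proof -
  obtain r where r: "rack_elem R x = (r, \<zero>)" "r \<in> rack_ring_carrier R T"
    using rack_elem_closed[OF assms(1)] by auto
  show ?thesis
    using rack_ring_carrierD(1)[OF r(2)] rack_ring_carrierD(1)[OF assms(2)] assms(3)
    by (simp add: r(1) a_minus_def[of "ext_rack_ring R T m"] ext_rack_ring_one ext_rack_ring_a_inv
        rack_ring_zero_closed ext_rack_ring_add ext_rack_ring_smult r_minus minus_eq minus_add a_comm)
qed

end

theorem theorem5p9:
  fixes R :: "('r, 'k) ring_scheme" and T :: "'t set" and m :: "'t \<Rightarrow> 't \<Rightarrow> 't" and x0 :: 't
  assumes "ring R" and "trivial_rack T m" and "x0 \<in> T"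
  shows "normalized_units R T m =
    {\<one>\<^bsub>ext_rack_ring R T m\<^esub> \<oplus>\<^bsub>ext_rack_ring R T m\<^esub> a \<oplus>\<^bsub>ext_rack_ring R T m\<^esub>
       \<alpha> \<odot>\<^bsub>ext_rack_ring R T m\<^esub>
         (rack_elem R x0 \<ominus>\<^bsub>ext_rack_ring R T m\<^esub> \<one>\<^bsub>ext_rack_ring R T m\<^esub>)
     | a \<alpha>. a \<in> augmentation_ideal R T \<and> \<alpha> \<in> carrier R \<and> \<alpha> \<ominus>\<^bsub>R\<^esub> \<one>\<^bsub>R\<^esub> \<in> Units R}"
proof -
  interpret ring R by fact
  let ?E = "ext_rack_ring R T m"
  let ?w = "\<lambda>a \<gamma>. \<one>\<^bsub>?E\<^esub> \<oplus>\<^bsub>?E\<^esub> a \<oplus>\<^bsub>?E\<^esub> \<gamma> \<odot>\<^bsub>?E\<^esub> (rack_elem R x0 \<ominus>\<^bsub>?E\<^esub> \<one>\<^bsub>?E\<^esub>)"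
  obtain r where r: "rack_elem R x0 = (r, \<zero>\<^bsub>R\<^esub>)" "r \<in> rack_ring_carrier R T"
    using rack_elem_closed[OF assms(3)] by auto
  note rz = rack_ring_carrierD(1)[OF r(2)]
  have w: "?w (a, \<zero>\<^bsub>R\<^esub>) \<gamma> = (\<lambda>z. a z \<oplus>\<^bsub>R\<^esub> \<gamma> \<otimes>\<^bsub>R\<^esub> r z, \<ominus>\<^bsub>R\<^esub> (\<gamma> \<ominus>\<^bsub>R\<^esub> \<one>\<^bsub>R\<^esub>))"
    if "a \<in> rack_ring_carrier R T" "\<gamma> \<in> carrier R" for a \<gamma>
    using one_add_smult_diff[OF assms(3) that] r(1) by simp
  have aug_r: "augmentation R (\<lambda>z. \<gamma> \<otimes>\<^bsub>R\<^esub> r z, \<gamma> \<otimes>\<^bsub>R\<^esub> \<zero>\<^bsub>R\<^esub>) = \<gamma>" if "\<gamma> \<in> carrier R" for \<gamma>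
    using augmentation_lmult[OF r(2) zero_closed that] augmentation_rack_elem[of x0] r(1) that by simp
  have aug_add: "augmentation R (\<lambda>z. a z \<oplus>\<^bsub>R\<^esub> \<gamma> \<otimes>\<^bsub>R\<^esub> r z, \<beta>) = augmentation R (a, \<beta>) \<oplus>\<^bsub>R\<^esub> \<gamma>"
    if "a \<in> rack_ring_carrier R T" "\<beta> \<in> carrier R" "\<gamma> \<in> carrier R" for a \<beta> \<gamma>
    using augmentation_add[OF that(1) rack_ring_lmult_closed[OF r(2) that(3)] that(2), of "\<gamma> \<otimes>\<^bsub>R\<^esub> \<zero>\<^bsub>R\<^esub>"]
      aug_r that by simp
  have aug_split: "augmentation R (a, \<beta>) = augmentation R (a, \<zero>\<^bsub>R\<^esub>) \<oplus>\<^bsub>R\<^esub> \<beta>"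
    if "a \<in> rack_ring_carrier R T" "\<beta> \<in> carrier R" for a \<beta>
    using that rack_ring_carrierD(1)[OF that(1)] by (simp add: augmentation_def Pi_def)
  show ?thesis
    unfolding normalized_units_trivial[OF assms(2)]
  proof (intro Set.equalityI subsetI, goal_cases)
    case (1 u)
    then obtain f \<beta> where u: "u = (f, \<beta>)" and f: "f \<in> rack_ring_carrier R T"
      and \<beta>: "\<beta> \<in> Units R" and aug: "augmentation R (f, \<beta>) = \<one>\<^bsub>R\<^esub>"
      by auto
    have \<beta>c: "\<beta> \<in> carrier R" using \<beta> by auto
    \<comment> \<open>Both witnesses are forced: matching \<open>e\<close>-coefficients requires
      \<open>1 - \<gamma> = \<beta>\<close>, and then \<open>a\<close> must be what is left of
      \<open>f\<close> after removing \<gamma> times the element \<open>x0\<close>.\<close>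
    define \<gamma> where "\<gamma> = \<one>\<^bsub>R\<^esub> \<ominus>\<^bsub>R\<^esub> \<beta>"
    define a where "a = (\<lambda>z. f z \<oplus>\<^bsub>R\<^esub> (\<ominus>\<^bsub>R\<^esub> \<gamma>) \<otimes>\<^bsub>R\<^esub> r z)"
    have \<gamma>: "\<gamma> \<in> carrier R" "\<ominus>\<^bsub>R\<^esub> (\<gamma> \<ominus>\<^bsub>R\<^esub> \<one>\<^bsub>R\<^esub>) = \<beta>"
      using \<beta>c by (auto simp: \<gamma>_def minus_eq minus_add a_comm r_neg1 r_neg2)
    have a: "a \<in> rack_ring_carrier R T"
      unfolding a_def using \<gamma>(1) f r(2) by (intro rack_ring_add_closed rack_ring_lmult_closed) auto
    \<comment> \<open>Dropping the \<open>e\<close>-part lowers the augmentation from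
      \<open>1\<close> to \<open>1 - \<beta>\<close>. This is exactly what subtracting \<gamma>
      times \<open>x0\<close> removes, so \<open>a\<close> has augmentation zero.\<close>
    have aug_f: "augmentation R (f, \<zero>\<^bsub>R\<^esub>) = \<gamma>"
      using aug aug_split[OF f \<beta>c] augmentation_closed[OF f zero_closed] \<beta>c
      by (metis \<gamma>_def a_assoc a_inv_closed minus_eq r_neg r_zero)
    then have "augmentation R (a, \<zero>\<^bsub>R\<^esub>) = \<zero>\<^bsub>R\<^esub>"
      using aug_add[OF f zero_closed, of "\<ominus>\<^bsub>R\<^esub> \<gamma>"] \<gamma>(1) by (simp add: a_def r_neg)
    then have "(a, \<zero>\<^bsub>R\<^esub>) \<in> augmentation_ideal R T"
      using a by (simp add: augmentation_ideal_def)
    moreover have "u = ?w (a, \<zero>\<^bsub>R\<^esub>) \<gamma>"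
      using w[OF a \<gamma>(1)] \<gamma> rz rack_ring_carrierD(1)[OF f]
      by (simp add: u a_def a_assoc l_minus l_neg)
    moreover have "\<gamma> \<ominus>\<^bsub>R\<^esub> \<one>\<^bsub>R\<^esub> \<in> Units R"
      using \<beta> \<gamma> a_inv_Units_iff[of "\<gamma> \<ominus>\<^bsub>R\<^esub> \<one>\<^bsub>R\<^esub>"] by simp
    ultimately show ?case
      using \<gamma>(1) by blast
  next
    case (2 u)
    then obtain a \<gamma> where u: "u = ?w (a, \<zero>\<^bsub>R\<^esub>) \<gamma>" and a: "a \<in> rack_ring_carrier R T"
      and aug: "augmentation R (a, \<zero>\<^bsub>R\<^esub>) = \<zero>\<^bsub>R\<^esub>"
      and \<gamma>: "\<gamma> \<in> carrier R" "\<gamma> \<ominus>\<^bsub>R\<^esub> \<one>\<^bsub>R\<^esub> \<in> Units R"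
      by (auto simp: augmentation_ideal_def)
    let ?\<beta> = "\<ominus>\<^bsub>R\<^esub> (\<gamma> \<ominus>\<^bsub>R\<^esub> \<one>\<^bsub>R\<^esub>)"
    have \<beta>: "?\<beta> \<in> carrier R" using \<gamma>(1) by simp
    \<comment> \<open>Here \<open>a\<close> contributes nothing, the multiple of \<open>x0\<close>
      contributes \<gamma>, and the \<open>e\<close>-part contributes
      \<open>1 - \<gamma>\<close>.\<close>
    have "augmentation R (\<lambda>z. a z \<oplus>\<^bsub>R\<^esub> \<gamma> \<otimes>\<^bsub>R\<^esub> r z, ?\<beta>) = ?\<beta> \<oplus>\<^bsub>R\<^esub> \<gamma>"
      using aug_add[OF a \<beta> \<gamma>(1)] aug_split[OF a \<beta>] aug \<beta> by simp
    also have "\<dots> = \<one>\<^bsub>R\<^esub>"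
      using \<gamma>(1) by (simp add: minus_eq minus_add a_ac a_lcomm[of \<gamma> "\<one>\<^bsub>R\<^esub>"] r_neg)
    finally show ?case
      using w[OF a \<gamma>(1)] u \<gamma> a r(2) a_inv_Units_iff[of "\<gamma> \<ominus>\<^bsub>R\<^esub> \<one>\<^bsub>R\<^esub>"]
      by (auto intro!: rack_ring_add_closed rack_ring_lmult_closed)
  qed
qed

end
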